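(* Let $a,b,c,d,e,x,y,z,w,u,q$ be nonzero complex numbers, let $r,s$ be nonnegative real numbers, and let $n\ge0$ be an integer. Assume that no denominator below vanishes. Then $$\frac{a}{c}\,\mathcal D\Bigl(\tfrac{ce}{a},\tfrac{bc}{a},\tfrac{cd}{a},\tfrac{bcde}{a}q^{2-4r}\Bigr)\sum_{k=0}^{n-1}\frac{1-\frac{bcde}{a}q^{4rk+2-4r}}{1-\frac{bcde}{a}q^{2-4r}}\,\frac{(bq,dq,eq,bc^2deq/a^2;q^{2r})_{k-1}}{(cdeq/a,bceq/a,bcdq/a,aq/c;q^{2r})_k}$$ $$\times\frac{(yq,wq,uq,yz^2wuq/x^2;q^{2s})_k}{(zwuq/x,yzuq/x,yzwq/x,xq/z;q^{2s})_k}\,q^{2rk+1-2r}$$ $$=\frac{(bq,dq,eq,bc^2deq/a^2;q^{2r})_{n-1}}{(cdeq/a,bceq/a,bcdq/a,aq/c;q^{2r})_{n-1}}\,\frac{(yq,wq,uq,yz^2wuq/x^2;q^{2s})_n}{(zwuq/x,yzuq/x,yzwq/x,xq/z;q^{2s})_n}$$ $$-\frac{(q^{2r-1}-cde/a)(q^{2r-1}-bce/a)(q^{2r-1}-bcd/a)(q^{2r-1}-a/c)}{(q^{2r-1}-b)(q^{2r-1}-d)(q^{2r-1}-e)(q^{2r-1}-bc^2de/a^2)}$$ $$-\frac{x}{z}\,\mathcal D\Bigl(\tfrac{yz}{x},\tfrac{zu}{x},\tfrac{zw}{x},\tfrac{yzwu}{x}q^2\Bigr)\sum_{k=0}^{n-1}\frac{1-\frac{yzwu}{x}q^{4sk+2}}{1-\frac{yzwu}{x}q^2}\,\frac{(yq,wq,uq,yz^2wuq/x^2;q^{2s})_k}{(zwuq/x,yzuq/x,yzwq/x,xq/z;q^{2s})_{k+1}}$$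 $$\times\frac{(bq,dq,eq,bc^2deq/a^2;q^{2r})_k}{(cdeq/a,bceq/a,bcdq/a,aq/c;q^{2r})_k}\,q^{2sk+1}.$$
   Context: $\mathcal D(x_1,\dots,x_m):=\prod_{i=1}^m(1-x_i)$. For a nonzero base $q$ and an integer $m\ge 0$, $(a;q)_m=\prod_{j=0}^{m-1}(1-aq^j)$, $(a;q)_{-1}=1/(1-a/q)$, and $(a_1,\dots,a_l;q)_m=\prod_{i=1}^l(a_i;q)_m$. Real powers are $q^t=\exp(t\log q)$ for a fixed choice of $\log q$. Empty sums are $0$. (The paper calls this a $(1,1)$-type transformation with degree $2m$, $m=\max\{r,s\}$.) *)

theory Defs
  imports Complex_Main
begin

text \<open>The only negative index in use is \<open>-1\<close>. If \<open>a = q\<close>, then the symbol with index \<open>-1\<close> is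
  undefined; here it has the value \<open>0\<close>, so its being nonzero expresses that it is defined.\<close>

definition qpoch :: "complex \<Rightarrow> complex \<Rightarrow> int \<Rightarrow> complex" where
  "qpoch a q m = (if m = -1 then 1 / (1 - a / q) else (\<Prod>j<nat m. 1 - a * q ^ j))"

definition qpochs :: "complex list \<Rightarrow> complex \<Rightarrow> int \<Rightarrow> complex" where
  "qpochs as q m = (\<Prod>a\<leftarrow>as. qpoch a q m)"

definition Dprod :: "complex list \<Rightarrow> complex" where
  "Dprod xs = (\<Prod>x\<leftarrow>xs. 1 - x)"

text \<open>The real power \<open>q\<^sup>t\<close>, where the argument \<open>L\<close> is the chosen value of \<open>log q\<close>
  (any complex number with \<open>exp L = q\<close>, not necessarily the principal branch).\<close>

definition qpow :: "complex \<Rightarrow> real \<Rightarrow> complex" where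
  "qpow L t = exp (of_real t * L)"

end

theory Submission
  imports Defs
begin

text \<open>Both sums are sums of differences of quotients of \<open>q\<close>-shifted factorials: with
  \<open>A\<^sub>k = (bq,\<dots>;q\<^sup>2\<^sup>r)\<^sub>k\<^sub>-\<^sub>1 / (cdeq/a,\<dots>;q\<^sup>2\<^sup>r)\<^sub>k\<^sub>-\<^sub>1\<close> and
  \<open>B\<^sub>k = (yq,\<dots>;q\<^sup>2\<^sup>s)\<^sub>k / (zwuq/x,\<dots>;q\<^sup>2\<^sup>s)\<^sub>k\<close>, the left-hand side is
  \<open>\<Sum> (A\<^sub>k\<^sub>+\<^sub>1 - A\<^sub>k) B\<^sub>k\<close> and the sum on the right is \<open>\<Sum> A\<^sub>k\<^sub>+\<^sub>1 (B\<^sub>k\<^sub>+\<^sub>1 - B\<^sub>k)\<close>, because of one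
  quartic polynomial identity. The theorem is then Abel's summation by parts.\<close>

lemma qpow_add: "qpow L (s + t) = qpow L s * qpow L t"
  by (simp add: qpow_def ring_distribs exp_add)

lemma qpow_nonzero [simp]: "qpow L t \<noteq> 0"
  by (simp add: qpow_def)

lemma qpow_of_nat_mult: "qpow L (of_nat k * t) = qpow L t ^ k"
  by (simp add: qpow_def mult.assoc flip: exp_of_nat_mult)

lemma qpow_of_int_mult: "qpow L (of_int m * t) = qpow L t powi m"
  by (simp add: qpow_def exp_power_int mult_ac)

text \<open>The usual recurrence, extended to index \<open>-1\<close>: there it is the cancellation
  of \<open>1 - g/p\<close> against its reciprocal, which is why \<open>g = p\<close> has to be
  excluded in that case.\<close>

lemma qpoch_Suc:
  assumes "m \<ge> -1" "m = -1 \<Longrightarrow> g \<noteq> p" "p \<noteq> 0"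
  shows "qpoch g p (m + 1) = qpoch g p m * (1 - g * p powi m)"
proof (cases "m = -1")
  case True
  then show ?thesis using assms by (simp add: qpoch_def field_simps)
next
  case False
  with \<open>m \<ge> -1\<close> have "m \<ge> 0" by linarith
  then obtain k where "m = int k" by (rule nonneg_int_cases)
  then show ?thesis by (simp add: qpoch_def nat_add_distrib)
qed

text \<open>For \<open>m = -1\<close> and \<open>g = p\<close> both sides are \<open>0\<close>, by the convention \<open>1 / 0 = 0\<close>.\<close>

lemma inverse_qpoch:
  assumes "m \<ge> -1" "p \<noteq> 0" "qpoch g p (m + 1) \<noteq> 0"
  shows "inverse (qpoch g p m) = (1 - g * p powi m) / qpoch g p (m + 1)"
proof (cases "m = -1")
  case True
  then show ?thesis by (simp add: qpoch_def field_simps)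
next
  case False
  then have "qpoch g p (m + 1) = qpoch g p m * (1 - g * p powi m)"
    using assms by (intro qpoch_Suc) auto
  then show ?thesis using assms(3) by (simp add: inverse_eq_divide)
qed

text \<open>The two quartics in \<open>T\<close> agree in the coefficients of \<open>T^0\<close>,
  \<open>T^2\<close> and \<open>T^4\<close>, so only a linear and a cubic term survive. Their ratio
  is \<open>- b*c*d*e/a\<close>, and the linear coefficient factors.\<close>

lemma quartic_identity:
  fixes a b c d e T :: "'a :: field"
  assumes "a \<noteq> 0" "c \<noteq> 0"
  shows "(1 - b*T) * (1 - d*T) * (1 - e*T) * (1 - b*c^2*d*e/a^2*T)
      - (1 - c*d*e/a*T) * (1 - b*c*e/a*T) * (1 - b*c*d/a*T) * (1 - a/c*T)
    = a/c * (1 - c*e/a) * (1 - b*c/a) * (1 - c*d/a) * (1 - b*c*d*e/a * T^2) * T"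
proof -
  \<comment> \<open>The parameters \<open>a\<close> and \<open>c\<close> enter only through
    \<open>c/a\<close>. A separate name for its inverse leaves a division-free identity modulo
    \<open>f * g = 1\<close>.\<close>
  define f where "f = c/a"
  have "f \<noteq> 0" using assms by (simp add: f_def)
  define g where "g = inverse f"
  have g: "f * g = 1" using \<open>f \<noteq> 0\<close> by (simp add: g_def)
  have "(1 - b*T) * (1 - d*T) * (1 - e*T) * (1 - b*f^2*d*e*T)
      - (1 - f*d*e*T) * (1 - b*f*e*T) * (1 - b*f*d*T) * (1 - g*T)
    = g * (1 - f*e) * (1 - b*f) * (1 - f*d) * (1 - b*f*d*e * T^2) * T"
    using g by algebra
  moreover have "a/c = g" "b*c^2*d*e/a^2 = b*f^2*d*e" "c*d*e/a = f*d*e" "b*c*e/a = b*f*e"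
    "b*c*d/a = b*f*d" "c*e/a = f*e" "b*c/a = b*f" "c*d/a = f*d" "b*c*d*e/a = b*f*d*e"
    using assms by (simp_all add: f_def g_def power_divide)
  ultimately show ?thesis by simp
qed

text \<open>One quotient serves both families: \<open>x\<close>, \<open>y\<close>, \<open>z\<close>,
  \<open>w\<close>, \<open>u\<close> in place of \<open>a\<close>, \<open>b\<close>,
  \<open>c\<close>, \<open>d\<close>, \<open>e\<close> give the factors with base
  \<open>q^(2s)\<close>.\<close>

definition qratio ::
  "complex \<Rightarrow> complex \<Rightarrow> complex \<Rightarrow> complex \<Rightarrow> complex \<Rightarrow> complex \<Rightarrow> complex \<Rightarrow> int \<Rightarrow> complex"
  where "qratio a b c d e q p m =
    qpochs [b*q, d*q, e*q, b*c^2*d*e*q/a^2] p m / qpochs [c*d*e*q/a, b*c*e*q/a, b*c*d*q/a, a*q/c] p m"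

text \<open>Over the common denominator of index \<open>m + 1\<close>, both terms are the numerator
  of index \<open>m\<close> times four linear factors in \<open>T\<close>;
  \<open>quartic_identity\<close> evaluates the difference of these products.\<close>

lemma qratio_diff:
  fixes a b c d e q p :: complex and m :: int
  defines "T \<equiv> q * p powi m"
  assumes "a \<noteq> 0" "c \<noteq> 0" "p \<noteq> 0" and m: "m \<ge> -1"
    and num: "m = -1 \<Longrightarrow> p \<notin> set [b*q, d*q, e*q, b*c^2*d*e*q/a^2]"
    and den: "qpochs [c*d*e*q/a, b*c*e*q/a, b*c*d*q/a, a*q/c] p (m + 1) \<noteq> 0"
  shows "qratio a b c d e q p (m + 1) - qratio a b c d e q p m =
    a/c * (1 - c*e/a) * (1 - b*c/a) * (1 - c*d/a) * (1 - b*c*d*e/a * T^2) * T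
      * (qpochs [b*q, d*q, e*q, b*c^2*d*e*q/a^2] p m
         / qpochs [c*d*e*q/a, b*c*e*q/a, b*c*d*q/a, a*q/c] p (m + 1))"
    (is "_ = ?w * (?N m / ?D (m + 1))")
proof -
  have N: "?N (m + 1) =
      ?N m * ((1 - b*T) * (1 - d*T) * (1 - e*T) * (1 - b*c^2*d*e/a^2*T))"
  proof -
    have "qpoch h p (m + 1) = qpoch h p m * (1 - g*T)"
      if "h = g*q" "h \<in> set [b*q, d*q, e*q, b*c^2*d*e*q/a^2]" for g h
      using qpoch_Suc[of m h p] num m \<open>p \<noteq> 0\<close> that by (auto simp: T_def mult.assoc)
    from this[of "b*q" b] this[of "d*q" d] this[of "e*q" e]
      this[of "b*c^2*d*e*q/a^2" "b*c^2*d*e/a^2"]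
    show ?thesis by (simp add: qpochs_def mult_ac)
  qed
  \<comment> \<open>The inverse form covers a denominator parameter equal to \<open>p\<close> at
    \<open>m = -1\<close>: then \<open>?D m\<close> is \<open>0\<close> by convention, and so is the
    factor on the right.\<close>
  have D: "inverse (?D m) =
      ((1 - c*d*e/a*T) * (1 - b*c*e/a*T) * (1 - b*c*d/a*T) * (1 - a/c*T)) / ?D (m + 1)"
    using den m \<open>p \<noteq> 0\<close> by (simp add: qpochs_def inverse_qpoch T_def mult_ac)
  have factor: "v * P / w - v * (R / w) = (P - R) * (v / w)" for v w P R :: complex
    by (simp add: diff_divide_distrib algebra_simps)
  have "qratio a b c d e q p (m + 1) - qratio a b c d e q p m =
      ((1 - b*T) * (1 - d*T) * (1 - e*T) * (1 - b*c^2*d*e/a^2*T)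
       - (1 - c*d*e/a*T) * (1 - b*c*e/a*T) * (1 - b*c*d/a*T) * (1 - a/c*T)) * (?N m / ?D (m + 1))"
    unfolding qratio_def N divide_inverse[of "?N m" "?D m"] D
    by (rule factor)
  then show ?thesis
    by (simp only: quartic_identity[OF \<open>a \<noteq> 0\<close> \<open>c \<noteq> 0\<close>])
qed

lemma qratio_0: "qratio a b c d e q p 0 = 1"
  by (simp add: qratio_def qpochs_def qpoch_def)

lemma qratio_minus_one:
  assumes "p = q * t" "q \<noteq> 0" "t \<noteq> 0"
  shows "qratio a b c d e q p (-1) =
    (t - c*d*e/a) * (t - b*c*e/a) * (t - b*c*d/a) * (t - a/c)
      / ((t - b) * (t - d) * (t - e) * (t - b*c^2*d*e/a^2))"
proof -
  \<comment> \<open>The four factors \<open>t\<close> from the numerator cancel those from the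
    denominator. For \<open>g = t\<close> both sides are \<open>0\<close>.\<close>
  have "qpoch (g*q) p (-1) = t / (t - g)" for g
    using assms by (cases "g = t") (simp_all add: qpoch_def field_simps)
  from this[of b] this[of d] this[of e] this[of "b*c^2*d*e/a^2"]
    this[of "c*d*e/a"] this[of "b*c*e/a"] this[of "b*c*d/a"] this[of "a/c"]
  show ?thesis using \<open>t \<noteq> 0\<close>
    by (simp add: qratio_def qpochs_def mult.assoc)
qed

text \<open>The differences of \<open>A k * B k\<close> telescope, and each splits as
  \<open>(A (Suc k) - A k) * B k + A (Suc k) * (B (Suc k) - B k)\<close>.\<close>

lemma sum_by_parts:
  fixes A B :: "nat \<Rightarrow> 'a :: comm_ring"
  shows "(\<Sum>k<n. (A (Suc k) - A k) * B k) =
    A n * B n - A 0 * B 0 - (\<Sum>k<n. (B (Suc k) - B k) * A (Suc k))"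
  by (induction n) (simp_all add: algebra_simps)

theorem corollary4p3:
  fixes a b c d e x y z w u q L :: complex and r s :: real and n :: nat
  assumes nonzero: "a \<noteq> 0" "b \<noteq> 0" "c \<noteq> 0" "d \<noteq> 0" "e \<noteq> 0"
      "x \<noteq> 0" "y \<noteq> 0" "z \<noteq> 0" "w \<noteq> 0" "u \<noteq> 0" "q \<noteq> 0"
    and log_q: "exp L = q"
    and rs_nonneg: "r \<ge> 0" "s \<ge> 0"
    and den_wp1: "1 - b*c*d*e/a * qpow L (2 - 4*r) \<noteq> 0"
    and den_wp2: "1 - y*z*w*u/x * q^2 \<noteq> 0"
    and den_const: "(qpow L (2*r - 1) - b) * (qpow L (2*r - 1) - d) * (qpow L (2*r - 1) - e)
          * (qpow L (2*r - 1) - b*c^2*d*e/a^2) \<noteq> 0"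
    and den_r_last: "qpochs [c*d*e*q/a, b*c*e*q/a, b*c*d*q/a, a*q/c] (qpow L (2*r)) (int n - 1) \<noteq> 0"
    and den_r: "\<And>k. k < n \<Longrightarrow>
          qpochs [c*d*e*q/a, b*c*e*q/a, b*c*d*q/a, a*q/c] (qpow L (2*r)) (int k) \<noteq> 0"
    and den_s: "\<And>k. k \<le> n \<Longrightarrow>
          qpochs [z*w*u*q/x, y*z*u*q/x, y*z*w*q/x, x*q/z] (qpow L (2*s)) (int k) \<noteq> 0"
  shows
    "a/c * Dprod [c*e/a, b*c/a, c*d/a, b*c*d*e/a * qpow L (2 - 4*r)] *
      (\<Sum>k<n.
        (1 - b*c*d*e/a * qpow L (4*r*real k + 2 - 4*r)) / (1 - b*c*d*e/a * qpow L (2 - 4*r))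
        * (qpochs [b*q, d*q, e*q, b*c^2*d*e*q/a^2] (qpow L (2*r)) (int k - 1)
           / qpochs [c*d*e*q/a, b*c*e*q/a, b*c*d*q/a, a*q/c] (qpow L (2*r)) (int k))
        * (qpochs [y*q, w*q, u*q, y*z^2*w*u*q/x^2] (qpow L (2*s)) (int k)
           / qpochs [z*w*u*q/x, y*z*u*q/x, y*z*w*q/x, x*q/z] (qpow L (2*s)) (int k))
        * qpow L (2*r*real k + 1 - 2*r))
    = qpochs [b*q, d*q, e*q, b*c^2*d*e*q/a^2] (qpow L (2*r)) (int n - 1)
        / qpochs [c*d*e*q/a, b*c*e*q/a, b*c*d*q/a, a*q/c] (qpow L (2*r)) (int n - 1)
        * (qpochs [y*q, w*q, u*q, y*z^2*w*u*q/x^2] (qpow L (2*s)) (int n)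
           / qpochs [z*w*u*q/x, y*z*u*q/x, y*z*w*q/x, x*q/z] (qpow L (2*s)) (int n))
      - (qpow L (2*r - 1) - c*d*e/a) * (qpow L (2*r - 1) - b*c*e/a)
          * (qpow L (2*r - 1) - b*c*d/a) * (qpow L (2*r - 1) - a/c)
        / ((qpow L (2*r - 1) - b) * (qpow L (2*r - 1) - d) * (qpow L (2*r - 1) - e)
          * (qpow L (2*r - 1) - b*c^2*d*e/a^2))
      - x/z * Dprod [y*z/x, z*u/x, z*w/x, y*z*w*u/x * q^2] *
      (\<Sum>k<n.
        (1 - y*z*w*u/x * qpow L (4*s*real k + 2)) / (1 - y*z*w*u/x * q^2)
        * (qpochs [y*q, w*q, u*q, y*z^2*w*u*q/x^2] (qpow L (2*s)) (int k)
           / qpochs [z*w*u*q/x, y*z*u*q/x, y*z*w*q/x, x*q/z] (qpow L (2*s)) (int k + 1))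
        * (qpochs [b*q, d*q, e*q, b*c^2*d*e*q/a^2] (qpow L (2*r)) (int k)
           / qpochs [c*d*e*q/a, b*c*e*q/a, b*c*d*q/a, a*q/c] (qpow L (2*r)) (int k))
        * qpow L (2*s*real k + 1))"
proof -
  define p where "p = qpow L (2*r)"
  define p' where "p' = qpow L (2*s)"
  define t where "t = qpow L (2*r - 1)"
  have q: "qpow L 1 = q" using log_q by (simp add: qpow_def)
  have q2: "qpow L 2 = q^2"
    using qpow_of_nat_mult[of L 2 1] q by simp
  have p: "p = q * t" and "t \<noteq> 0" "p \<noteq> 0" "p' \<noteq> 0"
    unfolding p_def t_def p'_def by (simp_all flip: q qpow_add)
  \<comment> \<open>The index is shifted so that \<open>A 0\<close> is the value at
    \<open>-1\<close>, the source of the isolated constant on the right-hand side.\<close>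
  define A where "A k = qratio a b c d e q p (int k - 1)" for k
  define B where "B k = qratio x y z w u q p' (int k)" for k
  \<comment> \<open>\<open>U k\<close> and \<open>V k\<close> are the values of \<open>T\<close> in
    \<open>qratio_diff\<close> at the indices \<open>k - 1\<close> and \<open>k\<close>; their
    squares give the powers in the quotients that open the summands.\<close>
  define U where "U k = qpow L (2*r*real k + 1 - 2*r)" for k
  define V where "V k = qpow L (2*s*real k + 1)" for k
  have U: "U k = q * p powi (int k - 1)" for k
    unfolding U_def p_def
    by (simp add: algebra_simps flip: qpow_of_int_mult qpow_add q)
  have V: "V k = q * p' powi (int k)" for k
    unfolding V_def p'_def
    by (simp add: algebra_simps flip: qpow_of_nat_mult qpow_add q)
  have U2: "qpow L (4*r*real k + 2 - 4*r) = (U k)^2" for k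
    unfolding U_def power2_eq_square by (simp add: algebra_simps flip: qpow_add)
  have V2: "qpow L (4*s*real k + 2) = (V k)^2" for k
    unfolding V_def power2_eq_square by (simp add: algebra_simps flip: qpow_add)
  have A_diff: "A (Suc k) - A k =
      a/c * (1 - c*e/a) * (1 - b*c/a) * (1 - c*d/a) * (1 - b*c*d*e/a * (U k)^2) * U k
      * (qpochs [b*q, d*q, e*q, b*c^2*d*e*q/a^2] p (int k - 1)
         / qpochs [c*d*e*q/a, b*c*e*q/a, b*c*d*q/a, a*q/c] p (int k))" if "k < n" for k
  proof -
    \<comment> \<open>Since \<open>p = q * t\<close>, this is the nonvanishing of the factors
      \<open>t - b\<close>, \<open>t - d\<close>, and so on. It is what \<open>qratio_diff\<close>
      demands at \<open>k = 0\<close>.\<close>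
    have "p \<notin> set [b*q, d*q, e*q, b*c^2*d*e*q/a^2]"
      using den_const \<open>q \<noteq> 0\<close> \<open>a \<noteq> 0\<close> unfolding t_def[symmetric] p
      by (auto simp: field_simps)
    then show ?thesis
      using qratio_diff[of a c p "int k - 1" b q d e] den_r[OF that] nonzero \<open>p \<noteq> 0\<close>
      by (simp add: A_def U p_def)
  qed
  have B_diff: "B (Suc k) - B k =
      x/z * (1 - z*u/x) * (1 - y*z/x) * (1 - z*w/x) * (1 - y*z*w*u/x * (V k)^2) * V k
      * (qpochs [y*q, w*q, u*q, y*z^2*w*u*q/x^2] p' (int k)
         / qpochs [z*w*u*q/x, y*z*u*q/x, y*z*w*q/x, x*q/z] p' (int k + 1))" if "k < n" for k
    using qratio_diff[of x z p' "int k" y q w u] den_s[of "Suc k"] that nonzero \<open>p' \<noteq> 0\<close>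
    by (simp add: B_def V p'_def add.commute)
  have "a/c * Dprod [c*e/a, b*c/a, c*d/a, b*c*d*e/a * qpow L (2 - 4*r)] *
      (\<Sum>k<n.
        (1 - b*c*d*e/a * qpow L (4*r*real k + 2 - 4*r)) / (1 - b*c*d*e/a * qpow L (2 - 4*r))
        * (qpochs [b*q, d*q, e*q, b*c^2*d*e*q/a^2] p (int k - 1)
           / qpochs [c*d*e*q/a, b*c*e*q/a, b*c*d*q/a, a*q/c] p (int k))
        * B k * U k) = (\<Sum>k<n. (A (Suc k) - A k) * B k)"
    unfolding sum_distrib_left
  proof (rule sum.cong)
    fix k assume "k \<in> {..<n}"
    then show "a/c * Dprod [c*e/a, b*c/a, c*d/a, b*c*d*e/a * qpow L (2 - 4*r)] *
       ((1 - b*c*d*e/a * qpow L (4*r*real k + 2 - 4*r)) / (1 - b*c*d*e/a * qpow L (2 - 4*r))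
        * (qpochs [b*q, d*q, e*q, b*c^2*d*e*q/a^2] p (int k - 1)
           / qpochs [c*d*e*q/a, b*c*e*q/a, b*c*d*q/a, a*q/c] p (int k))
        * B k * U k) = (A (Suc k) - A k) * B k"
      \<comment> \<open>The last factor of \<open>Dprod\<close> cancels against the denominator of
        the first quotient.\<close>
      using den_wp1 unfolding U2 by (auto simp: A_diff Dprod_def)
  qed simp
  moreover have "x/z * Dprod [y*z/x, z*u/x, z*w/x, y*z*w*u/x * q^2] *
      (\<Sum>k<n.
        (1 - y*z*w*u/x * qpow L (4*s*real k + 2)) / (1 - y*z*w*u/x * q^2)
        * (qpochs [y*q, w*q, u*q, y*z^2*w*u*q/x^2] p' (int k)
           / qpochs [z*w*u*q/x, y*z*u*q/x, y*z*w*q/x, x*q/z] p' (int k + 1))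
        * A (Suc k) * V k) = (\<Sum>k<n. (B (Suc k) - B k) * A (Suc k))"
    unfolding sum_distrib_left
  proof (rule sum.cong)
    fix k assume "k \<in> {..<n}"
    then show "x/z * Dprod [y*z/x, z*u/x, z*w/x, y*z*w*u/x * q^2] *
       ((1 - y*z*w*u/x * qpow L (4*s*real k + 2)) / (1 - y*z*w*u/x * q^2)
        * (qpochs [y*q, w*q, u*q, y*z^2*w*u*q/x^2] p' (int k)
           / qpochs [z*w*u*q/x, y*z*u*q/x, y*z*w*q/x, x*q/z] p' (int k + 1))
        * A (Suc k) * V k) = (B (Suc k) - B k) * A (Suc k)"
      using den_wp2 unfolding V2 by (auto simp: B_diff Dprod_def)
  qed simp
  moreover have "A 0 * B 0 = (t - c*d*e/a) * (t - b*c*e/a) * (t - b*c*d/a) * (t - a/c)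
      / ((t - b) * (t - d) * (t - e) * (t - b*c^2*d*e/a^2))"
    using qratio_minus_one[OF p \<open>q \<noteq> 0\<close> \<open>t \<noteq> 0\<close>] by (simp add: A_def B_def qratio_0)
  ultimately show ?thesis
    using sum_by_parts[of A B n]
    unfolding A_def B_def U_def V_def p_def p'_def t_def qratio_def by simp
qed

end
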